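(* Let $M_G$ be a mixed graph with $n\ge 3$ vertices, and let $G$ be its underlying graph with $m$ edges, maximum degree $\Delta$ and minimum degree $\delta$. Then for any $\alpha\in[0,1]$, the smallest eigenvalue $\mu_{\min}(A_\alpha)$ and the largest eigenvalue $\mu_{\max}(A_\alpha)$ of the matrix $A_\alpha$ of $M_G$ satisfy $$\mu_{\min}(A_\alpha)\le\frac{2\alpha m}{n}-\sqrt{\frac{\frac{n\alpha^2}{2}(\Delta-\delta)^2+\frac{2n^2\alpha^2}{n-2}\left(\frac{2m}{n}-\frac{\Delta+\delta}{2}\right)^2+2mn(1-\alpha)^2}{n^2(n-1)}}$$ and $$\mu_{\max}(A_\alpha)\ge\frac{2\alpha m}{n}+\sqrt{\frac{\frac{n\alpha^2}{2}(\Delta-\delta)^2+\frac{2n^2\alpha^2}{n-2}\left(\frac{2m}{n}-\frac{\Delta+\delta}{2}\right)^2+2mn(1-\alpha)^2}{n^2(n-1)}}.$$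
   Context: A mixed graph $M_G=(V,E,A)$ consists of a vertex set $V=\{v_1,\dots,v_n\}$, a set $E$ of undirected edges and a set $A$ of directed edges (arcs). All mixed graphs are finite and simple (no loops, no multiple edges or arcs), so any two distinct vertices are joined by at most one undirected edge or arc. The underlying graph $G$ is the simple undirected graph obtained by forgetting the directions of the arcs; its number of edges $m$ is thus the total number of undirected edges and arcs. The degree $d_i$ of $v_i$ is its degree in $G$, and $D=\mathrm{diag}(d_1,\dots,d_n)$. Let $\omega=\frac{1+i\sqrt3}{2}$. The Hermitian adjacency matrix of the second kind $H^\omega$ is the $n\times n$ matrix with $(v,u)$ entry equal to $\omega$ if there is an arc from $v$ to $u$, $\bar\omega$ if there is an arc from $u$ to $v$, $1$ if $\{v,u\}$ is an undirected edge, and $0$ otherwise. For $\alpha\in[0,1]$, $A_\alpha=\alpha D+(1-\alpha)H^\omega$, a Hermitian matrix, whose eigenvalues are real. *)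

theory Defs
  imports Complex_Main "Jordan_Normal_Form.Spectral_Radius"
begin

record 'v mixed_graph =
  verts :: "'v set"
  uedges :: "'v set set"
  arcs :: "('v \<times> 'v) set"

text \<open>Undirected edges are two-element vertex sets, and a pair \<open>(u, v)\<close> is the arc from \<open>u\<close> to \<open>v\<close>.
  The last two conditions say that two vertices are joined by at most one edge or arc.\<close>

definition simple_mixed_graph :: "'v mixed_graph \<Rightarrow> bool" where
  "simple_mixed_graph M \<longleftrightarrow>
     finite (verts M) \<and>
     (\<forall>e \<in> uedges M. e \<subseteq> verts M \<and> card e = 2) \<and>
     (\<forall>(u, v) \<in> arcs M. u \<in> verts M \<and> v \<in> verts M \<and> u \<noteq> v) \<and>
     (\<forall>(u, v) \<in> arcs M. (v, u) \<notin> arcs M) \<and>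
     (\<forall>(u, v) \<in> arcs M. {u, v} \<notin> uedges M)"

definition underlying_edges :: "'v mixed_graph \<Rightarrow> 'v set set" where
  "underlying_edges M = uedges M \<union> {{u, v} | u v. (u, v) \<in> arcs M}"

definition vdegree :: "'v mixed_graph \<Rightarrow> 'v \<Rightarrow> nat" where
  "vdegree M x = card {e \<in> underlying_edges M. x \<in> e}"

definition max_degree :: "'v mixed_graph \<Rightarrow> nat" where
  "max_degree M = Max (vdegree M ` verts M)"

definition min_degree :: "'v mixed_graph \<Rightarrow> nat" where
  "min_degree M = Min (vdegree M ` verts M)"

definition omega :: complex where
  "omega = (1 + \<i> * complex_of_real (sqrt 3)) / 2"

definition hentry :: "'v mixed_graph \<Rightarrow> 'v \<Rightarrow> 'v \<Rightarrow> complex" where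
  "hentry M x y =
     (if (x, y) \<in> arcs M then omega
      else if (y, x) \<in> arcs M then cnj omega
      else if {x, y} \<in> uedges M then 1
      else 0)"

text \<open>The matrices depend on an enumeration \<open>vs 0, \<dots>, vs (n - 1)\<close> of the vertices, where
  \<open>n\<close> is the number of vertices (matrix indices start at \<open>0\<close>).\<close>

definition H_omega :: "'v mixed_graph \<Rightarrow> (nat \<Rightarrow> 'v) \<Rightarrow> complex mat" where
  "H_omega M vs =
     mat (card (verts M)) (card (verts M)) (\<lambda>(i, j). hentry M (vs i) (vs j))"

definition degree_mat :: "'v mixed_graph \<Rightarrow> (nat \<Rightarrow> 'v) \<Rightarrow> complex mat" where
  "degree_mat M vs =
     mat (card (verts M)) (card (verts M))
       (\<lambda>(i, j). if i = j then of_nat (vdegree M (vs i)) else 0)"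

definition A_alpha :: "real \<Rightarrow> 'v mixed_graph \<Rightarrow> (nat \<Rightarrow> 'v) \<Rightarrow> complex mat" where
  "A_alpha \<alpha> M vs =
     complex_of_real \<alpha> \<cdot>\<^sub>m degree_mat M vs + complex_of_real (1 - \<alpha>) \<cdot>\<^sub>m H_omega M vs"

text \<open>Intended for Hermitian matrices of positive dimension, whose spectrum is a nonempty
  finite set of real numbers.\<close>

definition mu_min :: "complex mat \<Rightarrow> real" where
  "mu_min B = Min {x. complex_of_real x \<in> spectrum B}"

definition mu_max :: "complex mat \<Rightarrow> real" where
  "mu_max B = Max {x. complex_of_real x \<in> spectrum B}"

lemma A_alpha_carrier:
  "A_alpha \<alpha> M vs \<in> carrier_mat (card (verts M)) (card (verts M))"
  by (simp add: A_alpha_def H_omega_def degree_mat_def)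

lemma A_alpha_hermitian:
  assumes "simple_mixed_graph M" "i < card (verts M)" "j < card (verts M)"
  shows "A_alpha \<alpha> M vs $$ (j, i) = cnj (A_alpha \<alpha> M vs $$ (i, j))"
proof -
  have h: "hentry M y x = cnj (hentry M x y)" for x y
  proof -
    have "\<not> ((x, y) \<in> arcs M \<and> (y, x) \<in> arcs M)"
      using assms(1) unfolding simple_mixed_graph_def by blast
    moreover have "{y, x} = {x, y}"
      by (rule insert_commute)
    ultimately show ?thesis
      by (simp add: hentry_def)
  qed
  have "hentry M (vs j) (vs i) = cnj (hentry M (vs i) (vs j))"
    by (rule h)
  with assms(2,3) show ?thesis
    by (cases "i = j") (simp_all only: A_alpha_def H_omega_def degree_mat_def index_add_mat
        index_smult_mat index_mat dim_row_mat dim_col_mat prod.case complex_cnj_add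
        complex_cnj_mult complex_cnj_complex_of_real complex_cnj_of_nat complex_cnj_zero
        if_True if_False not_sym simp_thms)
qed

end

theory Submission
  imports Defs
begin

text \<open>
  The bounds come from the mean and the variance of the spectrum. Let \<open>\<lambda>\<^sub>1, \<dots>, \<lambda>\<^sub>n\<close> be the
  eigenvalues of \<open>A\<^sub>\<alpha>\<close> with multiplicity. Their sum is the trace \<open>2 \<alpha> m\<close>, because
  the diagonal carries only the degrees, and the sum of their squares is the sum of the squared
  moduli of the entries, \<open>\<alpha>\<^sup>2 (\<Sum>d\<^sub>i\<^sup>2) + (1 - \<alpha>)\<^sup>2 2 m\<close>, because every nonzero entry of
  \<open>H\<^sup>\<omega>\<close> has modulus 1 and each edge or arc contributes two of them
  (\<open>hermitian_extreme_eigenvalues\<close>, \<open>A_alpha_trace\<close>, \<open>A_alpha_norm\<close>).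

  A family of \<open>n\<close> reals with mean \<open>\<mu>\<close> and variance \<open>\<sigma>\<^sup>2\<close> has a member that is at least
  \<open>\<mu> + \<sigma> / sqrt (n - 1)\<close> and one that is at most \<open>\<mu> - \<sigma> / sqrt (n - 1)\<close>
  (\<open>upper_bound_ge_mean_plus_deviation\<close>). For the eigenvalues,
  \<open>n\<^sup>2 \<sigma>\<^sup>2 = \<alpha>\<^sup>2 (n (\<Sum>d\<^sub>i\<^sup>2) - (2 m)\<^sup>2) + 2 m n (1 - \<alpha>)\<^sup>2\<close>, so the remaining task is to bound the
  variance of the degree sequence from below in terms of \<open>\<Delta>\<close> and \<open>\<delta>\<close>
  (\<open>variance_ge_of_extremes\<close>): keep one vertex of degree \<open>\<Delta>\<close> and one of degree \<open>\<delta>\<close>, and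
  replace the other \<open>n - 2\<close> degrees by their average, which can only decrease the variance.
\<close>

section \<open>Inequalities for finite families of reals\<close>

lemma sum_squares_le_square_sum:
  fixes z :: "'a \<Rightarrow> real"
  assumes "finite I" and "\<And>i. i \<in> I \<Longrightarrow> 0 \<le> z i"
  shows "(\<Sum>i\<in>I. (z i)\<^sup>2) \<le> (\<Sum>i\<in>I. z i)\<^sup>2"
  using assms
proof (induction I rule: finite_induct)
  case (insert i I)
  then have "0 \<le> z i * sum z I"
    by (simp add: sum_nonneg)
  with insert show ?case
    by (simp add: power2_sum)
qed simp

lemma square_sum_le_card_times_sum_squares:
  fixes x :: "'a \<Rightarrow> real"
  shows "(\<Sum>i\<in>I. x i)\<^sup>2 \<le> real (card I) * (\<Sum>i\<in>I. (x i)\<^sup>2)"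
proof (cases "card I = 0")
  case True
  then show ?thesis by (cases "finite I") auto
next
  case False
  let ?N = "real (card I)" and ?S = "sum x I"
  have "0 \<le> (\<Sum>i\<in>I. (?N * x i - ?S)\<^sup>2)"
    by (simp add: sum_nonneg)
  also have "\<dots> = (\<Sum>i\<in>I. ?N\<^sup>2 * (x i)\<^sup>2 - (2 * ?N * ?S) * x i + ?S\<^sup>2)"
    by (intro sum.cong) (simp_all add: power2_diff power_mult_distrib mult_ac)
  also have "\<dots> = ?N\<^sup>2 * (\<Sum>i\<in>I. (x i)\<^sup>2) - (2 * ?N * ?S) * ?S + ?N * ?S\<^sup>2"
    by (simp only: sum.distrib sum_subtractf sum_constant flip: sum_distrib_left)
  also have "\<dots> = ?N * (?N * (\<Sum>i\<in>I. (x i)\<^sup>2) - ?S\<^sup>2)"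
    by (simp add: power2_eq_square algebra_simps)
  finally show ?thesis
    using False by (simp add: zero_le_mult_iff)
qed

text \<open>The gaps \<open>b - x i\<close> are nonnegative, so the sum of their squares is at most the square of
  their sum. Both sides depend only on \<open>b\<close>, the sum and the sum of squares of the \<open>x i\<close>, and
  solving for \<open>b\<close> gives the claim. The radicand is the variance divided by one less than the
  number of entries.\<close>

lemma upper_bound_ge_mean_plus_deviation:
  fixes x :: "'a \<Rightarrow> real"
  assumes "finite I" and "2 \<le> card I" and "\<And>i. i \<in> I \<Longrightarrow> x i \<le> b"
  shows "sum x I / card I
      + sqrt ((card I * (\<Sum>i\<in>I. (x i)\<^sup>2) - (sum x I)\<^sup>2) / ((real (card I))\<^sup>2 * (real (card I) - 1))) \<le> b"
proof -
  let ?N = "real (card I)" and ?S = "sum x I" and ?Q = "\<Sum>i\<in>I. (x i)\<^sup>2"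
  have N: "2 \<le> ?N"
    using assms(2) by simp
  have sum_gap: "(\<Sum>i\<in>I. b - x i) = ?N * b - ?S"
    by (simp add: sum_subtractf)
  have "(\<Sum>i\<in>I. (b - x i)\<^sup>2) \<le> (\<Sum>i\<in>I. b - x i)\<^sup>2"
    using assms by (intro sum_squares_le_square_sum) auto
  moreover have "(\<Sum>i\<in>I. (b - x i)\<^sup>2) = ?N * b\<^sup>2 - 2 * b * ?S + ?Q"
    by (simp add: power2_diff sum.distrib sum_subtractf sum_distrib_left)
  ultimately have "?N * b\<^sup>2 - 2 * b * ?S + ?Q \<le> (?N * b - ?S)\<^sup>2"
    by (simp only: sum_gap)
  then have "?N * (?N * b\<^sup>2 - 2 * b * ?S + ?Q) \<le> ?N * (?N * b - ?S)\<^sup>2"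
    using N by (intro mult_left_mono) auto
  then have "?N * ?Q - ?S\<^sup>2 \<le> (?N * b - ?S)\<^sup>2 * (?N - 1)"
    by (simp add: power2_eq_square algebra_simps)
  then have "(?N * ?Q - ?S\<^sup>2) / (?N\<^sup>2 * (?N - 1)) \<le> ((?N * b - ?S) / ?N)\<^sup>2"
    using N by (simp add: power_divide divide_simps mult.commute mult.left_commute)
  moreover have "0 \<le> (?N * b - ?S) / ?N"
    using assms N sum_nonneg[of I "\<lambda>i. b - x i"] by (simp add: sum_gap)
  ultimately have "sqrt ((?N * ?Q - ?S\<^sup>2) / (?N\<^sup>2 * (?N - 1))) \<le> (?N * b - ?S) / ?N"
    by (rule real_le_lsqrt[rotated])
  moreover have "(?N * b - ?S) / ?N = b - ?S / ?N"
    using N by (simp add: diff_divide_distrib)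
  ultimately show ?thesis by simp
qed

lemma lower_bound_le_mean_minus_deviation:
  fixes x :: "'a \<Rightarrow> real"
  assumes "finite I" and "2 \<le> card I" and "\<And>i. i \<in> I \<Longrightarrow> a \<le> x i"
  shows "a \<le> sum x I / card I
      - sqrt ((card I * (\<Sum>i\<in>I. (x i)\<^sup>2) - (sum x I)\<^sup>2) / ((real (card I))\<^sup>2 * (real (card I) - 1)))"
  using upper_bound_ge_mean_plus_deviation[of I "\<lambda>i. - x i" "- a"] assms
  by (simp add: sum_negf)

text \<open>By the Cauchy-Schwarz inequality the entries other than \<open>x p\<close> and \<open>x q\<close>, with sum \<open>T\<close>,
  contribute at least \<open>T\<^sup>2 / (card I - 2)\<close> to the sum of squares. With this value in place of their
  contribution the claim becomes an identity in \<open>x p\<close>, \<open>x q\<close> and \<open>T\<close>.\<close>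

lemma variance_ge_of_two_entries:
  fixes x :: "'a \<Rightarrow> real"
  assumes "finite I" and "3 \<le> card I" and "p \<in> I" and "q \<in> I" and "p \<noteq> q"
  shows "card I / 2 * (x p - x q)\<^sup>2
      + 2 * (real (card I))\<^sup>2 / (real (card I) - 2) * (sum x I / card I - (x p + x q) / 2)\<^sup>2
    \<le> card I * (\<Sum>i\<in>I. (x i)\<^sup>2) - (sum x I)\<^sup>2"
proof -
  let ?R = "I - {p, q}"
  define N where "N = real (card I)"
  define T where "T = sum x ?R"
  define W where "W = (\<Sum>i\<in>?R. (x i)\<^sup>2)"
  have N: "3 \<le> N"
    using assms(2) by (simp add: N_def)
  have split: "sum f I = f p + f q + sum f ?R" for f :: "'a \<Rightarrow> real"
    using assms sum.subset_diff[of "{p, q}" I f] by simp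
  have "card ?R = card I - 2"
    using assms by (simp add: card_Diff_subset)
  then have "real (card ?R) = N - 2"
    using assms(2) by (simp add: N_def)
  then have "T\<^sup>2 \<le> (N - 2) * W"
    using square_sum_le_card_times_sum_squares[of x ?R] by (simp add: T_def W_def)
  then have "N * (T\<^sup>2 / (N - 2)) \<le> N * W"
    using N by (intro mult_left_mono) (simp_all add: divide_simps mult.commute)
  moreover have "N / 2 * (x p - x q)\<^sup>2
      + 2 * N\<^sup>2 / (N - 2) * ((x p + x q + T) / N - (x p + x q) / 2)\<^sup>2
    = N * ((x p)\<^sup>2 + (x q)\<^sup>2) + N * (T\<^sup>2 / (N - 2)) - (x p + x q + T)\<^sup>2"
    using N by (simp add: divide_simps) (simp add: power2_eq_square algebra_simps)
  ultimately show ?thesis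
    unfolding N_def[symmetric] split T_def[symmetric] W_def[symmetric]
    by (simp add: algebra_simps)
qed

lemma variance_ge_of_extremes:
  fixes x :: "'a \<Rightarrow> real"
  assumes "finite I" and "3 \<le> card I"
  shows "card I / 2 * (Max (x ` I) - Min (x ` I))\<^sup>2
      + 2 * (real (card I))\<^sup>2 / (real (card I) - 2) * (sum x I / card I - (Max (x ` I) + Min (x ` I)) / 2)\<^sup>2
    \<le> card I * (\<Sum>i\<in>I. (x i)\<^sup>2) - (sum x I)\<^sup>2"
proof -
  have fin: "finite (x ` I)" and ne: "x ` I \<noteq> {}"
    using assms by auto
  have "\<exists>p\<in>I. \<exists>q\<in>I. p \<noteq> q \<and> x p = Max (x ` I) \<and> x q = Min (x ` I)"
    \<comment> \<open>For a constant family the maximum and the minimum may be attained at the same chosen index,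
      but then any two distinct indices serve.\<close>
  proof (cases "Max (x ` I) = Min (x ` I)")
    case True
    have const: "x i = Max (x ` I)" if "i \<in> I" for i
      using Max_ge[OF fin imageI[OF that]] Min_le[OF fin imageI[OF that]] True by linarith
    obtain p q where "p \<in> I" "q \<in> I" "p \<noteq> q"
      using assms card_le_Suc0_iff_eq[of I] by auto
    then show ?thesis
      using const True by metis
  next
    case False
    then show ?thesis
      using Max_in[OF fin ne] Min_in[OF fin ne] by force
  qed
  then show ?thesis
    using variance_ge_of_two_entries[OF assms, of _ _ x] by metis
qed

section \<open>Eigenvalues and traces\<close>

lemma trace_mult_commute:
  fixes A B :: "'a :: comm_semiring_0 mat"
  assumes "A \<in> carrier_mat n n" and "B \<in> carrier_mat n n"
  shows "(\<Sum>i<n. (A * B) $$ (i, i)) = (\<Sum>i<n. (B * A) $$ (i, i))"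
proof -
  have "(\<Sum>i<n. (A * B) $$ (i, i)) = (\<Sum>i<n. \<Sum>j<n. A $$ (i, j) * B $$ (j, i))"
    using assms by (intro sum.cong) (auto simp: scalar_prod_def atLeast0LessThan)
  also have "\<dots> = (\<Sum>j<n. \<Sum>i<n. B $$ (j, i) * A $$ (i, j))"
    by (subst sum.swap) (simp add: mult.commute)
  also have "\<dots> = (\<Sum>i<n. (B * A) $$ (i, i))"
    using assms by (intro sum.cong) (auto simp: scalar_prod_def atLeast0LessThan)
  finally show ?thesis .
qed

lemma trace_similar:
  fixes A B :: "'a :: comm_ring_1 mat"
  assumes "A \<in> carrier_mat n n" and "similar_mat_wit A B P Q"
  shows "(\<Sum>i<n. A $$ (i, i)) = (\<Sum>i<n. B $$ (i, i))"
proof -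
  note D = similar_mat_witD2[OF assms]
  have "A = P * (B * Q)"
    using D by (simp add: assoc_mult_mat[of P n n B n Q n])
  then have "(\<Sum>i<n. A $$ (i, i)) = (\<Sum>i<n. (B * Q * P) $$ (i, i))"
    using D trace_mult_commute[of P n "B * Q"] by simp
  also have "B * Q * P = B"
    using D by (simp add: assoc_mult_mat[of B n n Q n P n])
  finally show ?thesis .
qed

lemma upper_triangular_square_diag:
  fixes B :: "'a :: comm_ring_1 mat"
  assumes "B \<in> carrier_mat n n" and "upper_triangular B" and "i < n"
  shows "(B * B) $$ (i, i) = (B $$ (i, i))\<^sup>2"
proof -
  have "B $$ (i, j) * B $$ (j, i) = 0" if "j < n" "j \<noteq> i" for j
    using that assms upper_triangularD[of B j i] upper_triangularD[of B i j]
    by (cases "j < i") auto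
  then have "(\<Sum>j<n. B $$ (i, j) * B $$ (j, i)) = (\<Sum>j\<in>{i}. B $$ (i, j) * B $$ (j, i))"
    using assms by (intro sum.mono_neutral_right) auto
  moreover have "(B * B) $$ (i, i) = (\<Sum>j<n. B $$ (i, j) * B $$ (j, i))"
    using assms by (auto simp: scalar_prod_def atLeast0LessThan)
  ultimately show ?thesis
    by (simp add: power2_eq_square)
qed

text \<open>The diagonal of a Schur form \<open>B\<close> of \<open>A\<close> lists the eigenvalues with multiplicity. The trace
  is invariant under similarity, \<open>A * A\<close> is similar to \<open>B * B\<close>, and squaring a triangular matrix
  squares its diagonal entries.\<close>

lemma complex_trace_eigenvalues:
  fixes A :: "complex mat"
  assumes A: "A \<in> carrier_mat n n"
  obtains e where "\<And>i. i < n \<Longrightarrow> e i \<in> spectrum A"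
    and "(\<Sum>i<n. A $$ (i, i)) = (\<Sum>i<n. e i)"
    and "(\<Sum>i<n. (A * A) $$ (i, i)) = (\<Sum>i<n. (e i)\<^sup>2)"
proof -
  obtain es where es: "char_poly A = (\<Prod>a\<leftarrow>es. [:- a, 1:])"
    using char_poly_factorized[OF A] by blast
  obtain B P Q where "schur_decomposition A es = (B, P, Q)"
    by (cases "schur_decomposition A es")
  from schur_decomposition[OF A es this]
  have sim: "similar_mat_wit A B P Q" and ut: "upper_triangular B" and diag: "diag_mat B = es"
    by auto
  note D = similar_mat_witD2[OF A sim]
  have "similar_mat_wit (A * A) (B * B) P Q"
    using similar_mat_wit_pow[OF sim, of 2] D by (simp add: numeral_2_eq_2)
  then have "(\<Sum>i<n. (A * A) $$ (i, i)) = (\<Sum>i<n. (B * B) $$ (i, i))"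
    using A by (intro trace_similar) auto
  also have "\<dots> = (\<Sum>i<n. (B $$ (i, i))\<^sup>2)"
    using D ut by (intro sum.cong) (simp_all add: upper_triangular_square_diag[of B n] del: index_mult_mat)
  finally have sq: "(\<Sum>i<n. (A * A) $$ (i, i)) = (\<Sum>i<n. (B $$ (i, i))\<^sup>2)" .
  have "B $$ (i, i) \<in> spectrum A" if "i < n" for i
  proof -
    have "B $$ (i, i) \<in> set es"
      using that D by (auto simp: diag[symmetric] diag_mat_def)
    then show ?thesis
      by (simp add: spectrum_root_char_poly[OF A] es linear_poly_root)
  qed
  then show ?thesis
    using that[of "\<lambda>i. B $$ (i, i)"] trace_similar[OF A sim] sq by blast
qed

text \<open>For an eigenvector \<open>v\<close> the quadratic form \<open>q = v\<^sup>* A v\<close> equals \<open>k\<close> times the squared norm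
  \<open>r\<close> of \<open>v\<close>, and \<open>q\<close> is real since conjugation only exchanges the two summation indices.\<close>

lemma hermitian_eigenvalue_real:
  fixes A :: "complex mat"
  assumes A: "A \<in> carrier_mat n n"
    and herm: "\<And>i j. i < n \<Longrightarrow> j < n \<Longrightarrow> A $$ (j, i) = cnj (A $$ (i, j))"
    and k: "k \<in> spectrum A"
  shows "k \<in> \<real>"
proof -
  obtain v where v: "v \<in> carrier_vec n" "v \<noteq> 0\<^sub>v n" "A *\<^sub>v v = k \<cdot>\<^sub>v v"
    using k A by (auto simp: spectrum_def eigenvalue_def eigenvector_def)
  define q where "q = (\<Sum>i<n. \<Sum>j<n. cnj (v $ i) * A $$ (i, j) * v $ j)"
  define r where "r = (\<Sum>i<n. (cmod (v $ i))\<^sup>2)"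
  have row: "(\<Sum>j<n. A $$ (i, j) * v $ j) = k * v $ i" if "i < n" for i
  proof -
    have "(\<Sum>j<n. A $$ (i, j) * v $ j) = (A *\<^sub>v v) $ i"
      using A v(1) that by (auto simp: scalar_prod_def atLeast0LessThan)
    then show ?thesis
      using v that by simp
  qed
  have "q = (\<Sum>i<n. cnj (v $ i) * (k * v $ i))"
    unfolding q_def using row by (intro sum.cong) (auto simp: sum_distrib_left[symmetric] mult.assoc)
  also have "\<dots> = k * of_real r"
    unfolding r_def of_real_sum sum_distrib_left
    by (intro sum.cong) (auto simp: complex_norm_square mult_ac simp del: of_real_power)
  finally have qr: "q = k * of_real r" .
  have "cnj q = (\<Sum>i<n. \<Sum>j<n. cnj (v $ j) * A $$ (j, i) * v $ i)"
  proof -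
    have "cnj (cnj (v $ i) * A $$ (i, j) * v $ j) = cnj (v $ j) * A $$ (j, i) * v $ i"
      if "i < n" "j < n" for i j
      by (simp add: herm[OF that])
    then show ?thesis
      by (simp add: q_def cnj_sum del: complex_cnj_mult)
  qed
  also have "\<dots> = q"
    unfolding q_def by (subst sum.swap) (rule refl)
  finally have "cnj q = q" .
  then have "q \<in> \<real>"
    by (simp add: Reals_cnj_iff)
  obtain i where i: "i < n" "v $ i \<noteq> 0"
    using v(1,2) by (metis carrier_vecD eq_vecI index_zero_vec(1,2))
  have "0 < r"
    unfolding r_def using i by (intro sum_pos2[of _ i]) auto
  then have "k = q / of_real r"
    using qr by simp
  then show ?thesis
    using \<open>q \<in> \<real>\<close> by (simp add: Reals_divide)
qed

lemma hermitian_trace_square: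
  fixes A :: "complex mat"
  assumes A: "A \<in> carrier_mat n n"
    and herm: "\<And>i j. i < n \<Longrightarrow> j < n \<Longrightarrow> A $$ (j, i) = cnj (A $$ (i, j))"
  shows "(\<Sum>i<n. (A * A) $$ (i, i)) = of_real (\<Sum>i<n. \<Sum>j<n. (cmod (A $$ (i, j)))\<^sup>2)"
proof -
  have "(A * A) $$ (i, i) = of_real (\<Sum>j<n. (cmod (A $$ (i, j)))\<^sup>2)" if "i < n" for i
  proof -
    have "(A * A) $$ (i, i) = (\<Sum>j<n. A $$ (i, j) * A $$ (j, i))"
      using A that by (auto simp: scalar_prod_def atLeast0LessThan)
    also have "\<dots> = (\<Sum>j<n. of_real ((cmod (A $$ (i, j)))\<^sup>2))"
      by (intro sum.cong) (simp_all add: herm[OF that] complex_norm_square del: of_real_power)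
    finally show ?thesis by simp
  qed
  then show ?thesis by simp
qed

text \<open>Applies the mean and deviation bounds to the eigenvalues. Realness of the spectrum matters
  twice: it makes the family of eigenvalues real, and it puts each of them into the set whose
  extremes define \<open>mu_min\<close> and \<open>mu_max\<close>.\<close>

lemma hermitian_extreme_eigenvalues:
  fixes A :: "complex mat" and t s :: real
  assumes A: "A \<in> carrier_mat n n" and n: "2 \<le> n"
    and herm: "\<And>i j. i < n \<Longrightarrow> j < n \<Longrightarrow> A $$ (j, i) = cnj (A $$ (i, j))"
    and t: "(\<Sum>i<n. A $$ (i, i)) = of_real t"
    and s: "(\<Sum>i<n. \<Sum>j<n. (cmod (A $$ (i, j)))\<^sup>2) = s"
  shows "mu_min A \<le> t / n - sqrt ((n * s - t\<^sup>2) / ((real n)\<^sup>2 * (real n - 1)))"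
    and "t / n + sqrt ((n * s - t\<^sup>2) / ((real n)\<^sup>2 * (real n - 1))) \<le> mu_max A"
proof -
  obtain e where e: "\<And>i. i < n \<Longrightarrow> e i \<in> spectrum A"
    and e1: "(\<Sum>i<n. A $$ (i, i)) = (\<Sum>i<n. e i)"
    and e2: "(\<Sum>i<n. (A * A) $$ (i, i)) = (\<Sum>i<n. (e i)\<^sup>2)"
    using complex_trace_eigenvalues[OF A] by blast
  define x where "x i = Re (e i)" for i
  have ex: "e i = of_real (x i)" if "i < n" for i
    using hermitian_eigenvalue_real[OF A herm e] that by (simp add: x_def)
  have "of_real (\<Sum>i<n. x i) = complex_of_real t"
    using e1 t ex by simp
  then have sum1: "(\<Sum>i<n. x i) = t"
    by (simp only: of_real_eq_iff)
  have "of_real (\<Sum>i<n. (x i)\<^sup>2) = complex_of_real s"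
    using e2 ex by (simp add: hermitian_trace_square[OF A herm] s)
  then have sum2: "(\<Sum>i<n. (x i)\<^sup>2) = s"
    by (simp only: of_real_eq_iff)
  let ?S = "{x. complex_of_real x \<in> spectrum A}"
  have "?S = complex_of_real -` spectrum A"
    by auto
  then have fin: "finite ?S"
    using card_finite_spectrum(1)[OF A] by (simp add: finite_vimageI inj_of_real)
  have mem: "x i \<in> ?S" if "i < n" for i
    using e[OF that] ex[OF that] by simp
  have "mu_min A \<le> x i" "x i \<le> mu_max A" if "i \<in> {..<n}" for i
    using that mem fin unfolding mu_min_def mu_max_def by auto
  then show "mu_min A \<le> t / n - sqrt ((n * s - t\<^sup>2) / ((real n)\<^sup>2 * (real n - 1)))"
    and "t / n + sqrt ((n * s - t\<^sup>2) / ((real n)\<^sup>2 * (real n - 1))) \<le> mu_max A"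
    using lower_bound_le_mean_minus_deviation[of "{..<n}" "mu_min A" x]
      upper_bound_ge_mean_plus_deviation[of "{..<n}" x "mu_max A"] n
    by (simp_all add: sum1 sum2)
qed

section \<open>Degrees and entries of mixed graphs\<close>

lemma underlying_edge_doubleton:
  assumes "simple_mixed_graph M" and "e \<in> underlying_edges M"
  shows "e \<subseteq> verts M" and "card e = 2"
proof -
  consider "e \<in> uedges M" | u v where "(u, v) \<in> arcs M" "e = {u, v}"
    using assms(2) by (auto simp: underlying_edges_def)
  then have "e \<subseteq> verts M \<and> card e = 2"
  proof cases
    case 1
    then show ?thesis
      using assms(1) by (simp add: simple_mixed_graph_def)
  next
    case 2
    then have "u \<in> verts M" "v \<in> verts M" "u \<noteq> v"
      using assms(1) unfolding simple_mixed_graph_def by blast+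
    then show ?thesis
      using 2 by simp
  qed
  then show "e \<subseteq> verts M" and "card e = 2"
    by auto
qed

lemma finite_underlying_edges:
  assumes "simple_mixed_graph M"
  shows "finite (underlying_edges M)"
proof (rule finite_subset)
  show "underlying_edges M \<subseteq> Pow (verts M)"
    using underlying_edge_doubleton[OF assms] by auto
  show "finite (Pow (verts M))"
    using assms by (simp add: simple_mixed_graph_def)
qed

lemma handshake:
  assumes "simple_mixed_graph M"
  shows "(\<Sum>x\<in>verts M. vdegree M x) = 2 * card (underlying_edges M)"
  unfolding vdegree_def
proof (subst sum_multicount[where k = 2])
  show "finite (verts M)" "finite (underlying_edges M)"
    using assms finite_underlying_edges by (auto simp: simple_mixed_graph_def)
  have "{x \<in> verts M. x \<in> e} = e" if "e \<in> underlying_edges M" for e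
    using underlying_edge_doubleton[OF assms that] by auto
  then show "\<forall>e\<in>underlying_edges M. card {x \<in> verts M. x \<in> e} = 2"
    using underlying_edge_doubleton[OF assms] by auto
qed simp

text \<open>Degrees count incident edges while matrix rows run over vertices; since the graph is simple,
  sending a neighbour \<open>y\<close> to the edge \<open>{x, y}\<close> matches the two counts.\<close>

lemma vdegree_eq_card_neighbours:
  assumes "simple_mixed_graph M"
  shows "vdegree M x = card {y \<in> verts M. {x, y} \<in> underlying_edges M}"
proof -
  have "bij_betw (\<lambda>y. {x, y}) {y \<in> verts M. {x, y} \<in> underlying_edges M}
      {e \<in> underlying_edges M. x \<in> e}"
  proof (rule bij_betw_imageI)
    show "inj_on (\<lambda>y. {x, y}) {y \<in> verts M. {x, y} \<in> underlying_edges M}"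
      by (auto simp: inj_on_def doubleton_eq_iff)
    show "(\<lambda>y. {x, y}) ` {y \<in> verts M. {x, y} \<in> underlying_edges M}
        = {e \<in> underlying_edges M. x \<in> e}"
    proof (intro equalityI subsetI)
      fix e assume "e \<in> {e \<in> underlying_edges M. x \<in> e}"
      then have e: "e \<in> underlying_edges M" "x \<in> e" by auto
      then obtain y where "e = {x, y}"
        using underlying_edge_doubleton(2)[OF assms e(1)] by (auto simp: card_2_iff)
      then show "e \<in> (\<lambda>y. {x, y}) ` {y \<in> verts M. {x, y} \<in> underlying_edges M}"
        using e underlying_edge_doubleton(1)[OF assms e(1)] by auto
    qed auto
  qed
  then show ?thesis
    unfolding vdegree_def by (rule bij_betw_same_card[symmetric])
qed

lemma cmod_omega: "cmod omega = 1"
  by (simp add: omega_def cmod_def power2_eq_square)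

lemma cmod_hentry:
  "cmod (hentry M x y) = (if {x, y} \<in> underlying_edges M then 1 else 0)"
proof -
  have "{x, y} \<in> underlying_edges M \<longleftrightarrow> (x, y) \<in> arcs M \<or> (y, x) \<in> arcs M \<or> {x, y} \<in> uedges M"
    unfolding underlying_edges_def by (auto simp: doubleton_eq_iff)
  then show ?thesis
    by (simp add: hentry_def cmod_omega)
qed

lemma hentry_row_norm:
  assumes "simple_mixed_graph M"
  shows "(\<Sum>y\<in>verts M. (cmod (hentry M x y))\<^sup>2) = vdegree M x"
proof -
  have "finite (verts M)"
    using assms by (simp add: simple_mixed_graph_def)
  moreover have "(\<Sum>y\<in>verts M. (cmod (hentry M x y))\<^sup>2)
      = (\<Sum>y\<in>verts M. if {x, y} \<in> underlying_edges M then 1 else 0)"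
    by (intro sum.cong) (auto simp: cmod_hentry)
  ultimately show ?thesis
    by (simp add: vdegree_eq_card_neighbours[OF assms] sum.If_cases Int_def)
qed

lemma hentry_diag:
  assumes "simple_mixed_graph M"
  shows "hentry M x x = 0"
  using cmod_hentry[of M x x] underlying_edge_doubleton(2)[OF assms, of "{x}"]
  by (auto split: if_splits)

lemma A_alpha_index:
  assumes "i < card (verts M)" and "j < card (verts M)"
  shows "A_alpha \<alpha> M vs $$ (i, j) =
    (if i = j then of_real (\<alpha> * vdegree M (vs i)) else 0) + of_real (1 - \<alpha>) * hentry M (vs i) (vs j)"
  using assms by (simp add: A_alpha_def H_omega_def degree_mat_def)

text \<open>No cross term appears: off the diagonal the degree matrix vanishes, and on the diagonal
  \<open>H\<^sup>\<omega>\<close> vanishes.\<close>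

lemma A_alpha_norm_entry:
  assumes "simple_mixed_graph M" and "i < card (verts M)" and "j < card (verts M)"
  shows "(cmod (A_alpha \<alpha> M vs $$ (i, j)))\<^sup>2 =
    (if i = j then \<alpha>\<^sup>2 * (vdegree M (vs i))\<^sup>2 else 0)
      + (1 - \<alpha>)\<^sup>2 * (cmod (hentry M (vs i) (vs j)))\<^sup>2"
  using assms
  by (auto simp: A_alpha_index hentry_diag norm_mult power_mult_distrib
      simp del: of_real_mult of_real_diff)

lemma A_alpha_trace:
  assumes "simple_mixed_graph M" and "bij_betw vs {..<card (verts M)} (verts M)"
  shows "(\<Sum>i<card (verts M). A_alpha \<alpha> M vs $$ (i, i))
    = of_real (2 * \<alpha> * card (underlying_edges M))"
proof -
  have "(\<Sum>i<card (verts M). A_alpha \<alpha> M vs $$ (i, i))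
      = of_real (\<alpha> * (\<Sum>i<card (verts M). real (vdegree M (vs i))))"
    by (simp add: A_alpha_index hentry_diag[OF assms(1)] sum_distrib_left)
  also have "(\<Sum>i<card (verts M). real (vdegree M (vs i))) = real (\<Sum>x\<in>verts M. vdegree M x)"
    using sum.reindex_bij_betw[OF assms(2), of "\<lambda>x. real (vdegree M x)"] by simp
  finally show ?thesis
    by (simp add: handshake[OF assms(1)] del: of_nat_sum)
qed

lemma A_alpha_norm:
  assumes "simple_mixed_graph M" and "bij_betw vs {..<card (verts M)} (verts M)"
  shows "(\<Sum>i<card (verts M). \<Sum>j<card (verts M). (cmod (A_alpha \<alpha> M vs $$ (i, j)))\<^sup>2)
    = \<alpha>\<^sup>2 * (\<Sum>x\<in>verts M. (real (vdegree M x))\<^sup>2) + (1 - \<alpha>)\<^sup>2 * (2 * card (underlying_edges M))"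
proof -
  let ?n = "card (verts M)"
  have row: "(\<Sum>j<?n. (cmod (A_alpha \<alpha> M vs $$ (i, j)))\<^sup>2)
      = \<alpha>\<^sup>2 * (real (vdegree M (vs i)))\<^sup>2 + (1 - \<alpha>)\<^sup>2 * real (vdegree M (vs i))" if "i < ?n" for i
  proof -
    have "(\<Sum>j<?n. (cmod (A_alpha \<alpha> M vs $$ (i, j)))\<^sup>2)
        = \<alpha>\<^sup>2 * (real (vdegree M (vs i)))\<^sup>2
          + (1 - \<alpha>)\<^sup>2 * (\<Sum>j<?n. (cmod (hentry M (vs i) (vs j)))\<^sup>2)"
      using that by (simp add: A_alpha_norm_entry[OF assms(1)] sum.distrib sum_distrib_left)
    then show ?thesis
      using sum.reindex_bij_betw[OF assms(2), of "\<lambda>y. (cmod (hentry M (vs i) y))\<^sup>2"]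
      by (simp add: hentry_row_norm[OF assms(1)])
  qed
  have "(\<Sum>i<?n. \<Sum>j<?n. (cmod (A_alpha \<alpha> M vs $$ (i, j)))\<^sup>2)
      = (\<Sum>i<?n. \<alpha>\<^sup>2 * (real (vdegree M (vs i)))\<^sup>2 + (1 - \<alpha>)\<^sup>2 * real (vdegree M (vs i)))"
    using row by (intro sum.cong) auto
  also have "\<dots> = (\<Sum>x\<in>verts M. \<alpha>\<^sup>2 * (real (vdegree M x))\<^sup>2 + (1 - \<alpha>)\<^sup>2 * real (vdegree M x))"
    by (rule sum.reindex_bij_betw[OF assms(2)])
  also have "\<dots> = \<alpha>\<^sup>2 * (\<Sum>x\<in>verts M. (real (vdegree M x))\<^sup>2)
      + (1 - \<alpha>)\<^sup>2 * real (\<Sum>x\<in>verts M. vdegree M x)"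
    by (simp add: sum.distrib sum_distrib_left)
  finally show ?thesis
    by (simp add: handshake[OF assms(1)] del: of_nat_sum)
qed

section \<open>The eigenvalue bounds\<close>

theorem theorem3p4:
  fixes M :: "'v mixed_graph" and vs :: "nat \<Rightarrow> 'v" and n m \<Delta> \<delta> :: nat and \<alpha> :: real
  assumes "simple_mixed_graph M"
    and "n = card (verts M)"
    and "n \<ge> 3"
    and "bij_betw vs {0..<n} (verts M)"
    and "m = card (underlying_edges M)"
    and "\<Delta> = max_degree M"
    and "\<delta> = min_degree M"
    and "0 \<le> \<alpha>" and "\<alpha> \<le> 1"
  shows "mu_min (A_alpha \<alpha> M vs) \<le>
      2 * \<alpha> * real m / real n
      - sqrt ((real n * \<alpha>^2 / 2 * (real \<Delta> - real \<delta>)^2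
               + 2 * (real n)^2 * \<alpha>^2 / (real n - 2)
                   * (2 * real m / real n - (real \<Delta> + real \<delta>) / 2)^2
               + 2 * real m * real n * (1 - \<alpha>)^2)
              / ((real n)^2 * (real n - 1)))
    \<and> mu_max (A_alpha \<alpha> M vs) \<ge>
      2 * \<alpha> * real m / real n
      + sqrt ((real n * \<alpha>^2 / 2 * (real \<Delta> - real \<delta>)^2
               + 2 * (real n)^2 * \<alpha>^2 / (real n - 2)
                   * (2 * real m / real n - (real \<Delta> + real \<delta>) / 2)^2
               + 2 * real m * real n * (1 - \<alpha>)^2)
              / ((real n)^2 * (real n - 1)))"
proof -
  define A where "A = A_alpha \<alpha> M vs"
  define d where "d x = real (vdegree M x)" for x
  define Q where "Q = (\<Sum>x\<in>verts M. (d x)\<^sup>2)"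
  define s where "s = \<alpha>\<^sup>2 * Q + (1 - \<alpha>)\<^sup>2 * (2 * real m)"
  \<comment> \<open>\<open>K\<close> is the lower bound for \<open>n\<^sup>2\<close> times the variance of the degrees, and \<open>s\<close> is the sum of the
    squared eigenvalues.\<close>
  define K where "K = real n / 2 * (real \<Delta> - real \<delta>)\<^sup>2
      + 2 * (real n)\<^sup>2 / (real n - 2) * (2 * real m / real n - (real \<Delta> + real \<delta>) / 2)\<^sup>2"
  let ?b = "real n * \<alpha>^2 / 2 * (real \<Delta> - real \<delta>)^2
               + 2 * (real n)^2 * \<alpha>^2 / (real n - 2)
                   * (2 * real m / real n - (real \<Delta> + real \<delta>) / 2)^2
               + 2 * real m * real n * (1 - \<alpha>)^2"
  have bij: "bij_betw vs {..<card (verts M)} (verts M)"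
    using assms by (simp add: atLeast0LessThan)
  have fin: "finite (verts M)" and ne: "verts M \<noteq> {}"
    using assms by (auto simp: simple_mixed_graph_def)
  have sum_d: "sum d (verts M) = 2 * real m"
    using handshake[OF assms(1)] assms(5) by (simp add: d_def flip: of_nat_sum)
  have "d ` verts M = real ` vdegree M ` verts M"
    by (auto simp: d_def)
  then have extremes: "Max (d ` verts M) = real \<Delta>" "Min (d ` verts M) = real \<delta>"
    using fin ne assms(6,7)
    by (simp_all add: max_degree_def min_degree_def mono_Max_commute mono_Min_commute mono_def)
  have "K \<le> n * Q - (2 * real m)\<^sup>2"
    using variance_ge_of_extremes[OF fin, of d] assms(2,3) sum_d extremes
    by (simp add: K_def Q_def)
  then have "\<alpha>\<^sup>2 * K \<le> \<alpha>\<^sup>2 * (n * Q - (2 * real m)\<^sup>2)"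
    by (rule mult_left_mono) simp
  moreover have "?b = \<alpha>\<^sup>2 * K + 2 * real m * real n * (1 - \<alpha>)\<^sup>2"
    by (simp add: K_def algebra_simps)
  moreover have "n * s - (2 * \<alpha> * real m)\<^sup>2
      = \<alpha>\<^sup>2 * (n * Q - (2 * real m)\<^sup>2) + 2 * real m * real n * (1 - \<alpha>)\<^sup>2"
    by (simp add: s_def power2_eq_square algebra_simps)
  ultimately have "?b \<le> n * s - (2 * \<alpha> * real m)\<^sup>2"
    by linarith
  then have sqrt_le: "sqrt (?b / ((real n)\<^sup>2 * (real n - 1)))
      \<le> sqrt ((n * s - (2 * \<alpha> * real m)\<^sup>2) / ((real n)\<^sup>2 * (real n - 1)))"
    using assms(3) by (intro real_sqrt_le_mono divide_right_mono) auto
  have carrier: "A \<in> carrier_mat n n"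
    using A_alpha_carrier by (simp add: A_def assms(2))
  have herm: "A $$ (j, i) = cnj (A $$ (i, j))" if "i < n" "j < n" for i j
    unfolding A_def by (rule A_alpha_hermitian[OF assms(1)]) (use that assms(2) in simp_all)
  have tr: "(\<Sum>i<n. A $$ (i, i)) = of_real (2 * \<alpha> * real m)"
    using A_alpha_trace[OF assms(1) bij] by (simp add: A_def assms(2,5))
  have fr: "(\<Sum>i<n. \<Sum>j<n. (cmod (A $$ (i, j)))\<^sup>2) = s"
    using A_alpha_norm[OF assms(1) bij] by (simp add: A_def s_def Q_def d_def assms(2,5))
  have "2 \<le> n"
    using assms(3) by simp
  note hermitian_extreme_eigenvalues[OF carrier this herm tr fr]
  with sqrt_le show ?thesis
    unfolding A_def by linarith
qed

end
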